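(* There is an absolute constant $C>0$ such that for all integers $n,r$ with $2\leq r\leq\log n$, the unique positive solution $x$ of $\sum_{j=1}^r x^j=n$ satisfies \[ x=n^{1/r}-\frac1r-\sum_{N=2}^{r}\frac{\Gamma(N+(N-1)/r)}{(N-1)\,\Gamma(N+1)\,\Gamma((N-1)/r)}\,n^{-(N-1)/r}+\frac1r\,n^{-1+1/r}+\varepsilon_{n,r}, \] with $|\varepsilon_{n,r}|\leq C/n$.
   Context: $\Gamma$ is the Euler gamma function and $\log$ is the natural logarithm. *)

theory Defs
  imports "HOL-Analysis.Analysis"
begin

definition is_pos_sol :: "nat \<Rightarrow> nat \<Rightarrow> real \<Rightarrow> bool" where
  "is_pos_sol n r x \<longleftrightarrow> x > 0 \<and> (\<Sum>j=1..r. x ^ j) = real n"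

end

theory Submission
  imports Defs
begin

text \<open>
  The equation reads \<open>(n + 1) x = x ^ (r + 1) + n\<close> with the root \<open>x = 1\<close> removed. Put \<open>d = 1 / n\<close>,
  \<open>t = n powr (- 1 / r)\<close> and \<open>s = t (1 + d) powr (- 1 - 1 / r)\<close>. Then \<open>v = 1 / ((1 + d) x)\<close> solves
  \<open>v = s (1 - v) powr (- 1 / r)\<close>, and Lagrange inversion expands \<open>1 / v\<close> in powers of \<open>s\<close>. The expansion
  is obtained from the Rothe--Hagen convolution identity, which says that the generating series
  \<open>G a\<close> of the Rothe coefficients satisfy \<open>G (a + b) = G a * G b\<close>; together with
  \<open>G 1 = 1 + s G (1 + 1 / r)\<close> this makes \<open>v = s G (1 / r)\<close> a root, with inverse \<open>G (- 1 / r) / s\<close>.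
  As \<open>t \<le> 1 / e\<close> lies uniformly inside the interval of convergence, truncating after \<open>s ^ (r - 1)\<close> and
  replacing \<open>s\<close> by \<open>t\<close> both cost \<open>O(t ^ r) = O(1 / n)\<close>; only the leading term \<open>1 / s\<close> contributes the
  extra \<open>d / (r t)\<close>.
\<close>

definition rothe :: "real \<Rightarrow> nat \<Rightarrow> real \<Rightarrow> real" where
  "rothe q k a = (if k = 0 then 1 else a * pochhammer (a + real k * q + 1) (k - 1) / fact k)"

lemma rothe_0 [simp]: "rothe q 0 a = 1"
  by (simp add: rothe_def)

lemma rothe_Suc: "rothe q (Suc k) a = a * pochhammer (a + real (Suc k) * q + 1) k / fact (Suc k)"
  by (simp add: rothe_def)

text \<open>Pascal's rule for Rothe coefficients: the two on the left share all but one factor of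
  their rising products. It lowers the index in \<open>rothe_hagen\<close>, and at
  \<open>a = 0\<close> it links the series at 1 and at \<open>1 + q\<close>.\<close>

lemma rothe_difference: "rothe q (Suc k) (a + 1) - rothe q (Suc k) a = rothe q k (a + 1 + q)"
proof (cases k)
  case 0
  then show ?thesis by (simp add: rothe_def)
next
  case (Suc m)
  define u where "u = a + real (Suc k) * q + 1"
  define P where "P = pochhammer (u + 1) m"
  have 1: "rothe q (Suc k) (a + 1) = (a + 1) * (P * (u + 1 + real m)) / fact (Suc k)"
    unfolding rothe_Suc u_def P_def Suc by (simp add: pochhammer_Suc algebra_simps)
  have 2: "rothe q (Suc k) a = a * (u * P) / fact (Suc k)"
    unfolding rothe_Suc u_def P_def Suc by (simp add: pochhammer_rec algebra_simps)
  have "a + 1 + q + real (Suc m) * q + 1 = u + 1"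
    unfolding u_def Suc by (simp add: algebra_simps)
  then have 3: "rothe q k (a + 1 + q) = (a + 1 + q) * P / fact k"
    unfolding Suc rothe_Suc P_def by (simp only:)
  have "(a + 1) * (P * (u + 1 + real m)) - a * (u * P) = real (Suc k) * ((a + 1 + q) * P)"
    unfolding u_def Suc by (simp add: algebra_simps)
  then show ?thesis
    unfolding 1 2 3 diff_divide_distrib[symmetric] by (simp del: of_nat_Suc)
qed

lemma pochhammer_polynomial:
  fixes c :: real
  shows "\<exists>P. \<forall>a. pochhammer (a + c) m = poly P a"
proof (induction m)
  case 0
  have "\<forall>a. pochhammer (a + c) 0 = poly 1 a" by simp
  then show ?case by blast
next
  case (Suc m)
  then obtain P where "\<forall>a. pochhammer (a + c) m = poly P a" by blast
  then have "\<forall>a. pochhammer (a + c) (Suc m) = poly (P * [:c + real m, 1:]) a"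
    by (simp add: pochhammer_Suc algebra_simps)
  then show ?case by blast
qed

lemma rothe_polynomial: "\<exists>P. \<forall>a. rothe q k a = poly P a"
proof (cases k)
  case 0
  have "\<forall>a. rothe q 0 a = poly 1 a" by simp
  then show ?thesis unfolding 0 by blast
next
  case (Suc m)
  obtain P where P: "\<forall>a. pochhammer (a + (real (Suc m) * q + 1)) m = poly P a"
    using pochhammer_polynomial by blast
  have "\<forall>a. rothe q (Suc m) a = poly (smult (1 / fact (Suc m)) ([:0, 1:] * P)) a"
    using P by (simp add: rothe_Suc add.assoc)
  then show ?thesis unfolding Suc by blast
qed

text \<open>Both sides are polynomials in \<open>a\<close>; by induction on \<open>n\<close> their difference has period 1, and
  it vanishes at \<open>a = 0\<close>.\<close>

lemma rothe_hagen: "(\<Sum>k\<le>n. rothe q k a * rothe q (n - k) b) = rothe q n (a + b)"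
proof (induction n arbitrary: a)
  case 0
  then show ?case by simp
next
  case (Suc n)
  define D where "D a = (\<Sum>k\<le>Suc n. rothe q k a * rothe q (Suc n - k) b) - rothe q (Suc n) (a + b)" for a
  have periodic: "D (a + 1) = D a" for a
  proof -
    have "D (a + 1) - D a =
        (\<Sum>k\<le>Suc n. (rothe q k (a + 1) - rothe q k a) * rothe q (Suc n - k) b)
        - (rothe q (Suc n) (a + b + 1) - rothe q (Suc n) (a + b))"
      unfolding D_def by (simp add: left_diff_distrib sum_subtractf add_ac)
    also have "\<dots> = (\<Sum>k\<le>n. rothe q k (a + 1 + q) * rothe q (n - k) b) - rothe q n (a + b + 1 + q)"
      unfolding rothe_difference sum.atMost_Suc_shift by simp
    also have "\<dots> = 0"
      \<comment> \<open>The induction hypothesis is used at \<open>a + 1 + q\<close>, hence the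
        induction with \<open>a\<close> arbitrary.\<close>
      unfolding Suc by (simp add: add_ac)
    finally show ?thesis by simp
  qed
  have "D 0 = 0"
    unfolding D_def sum.atMost_Suc_shift by (simp add: rothe_Suc)
  then have nat: "D (real m) = 0" for m
    by (induction m) (simp, metis add.commute of_nat_Suc periodic)
  have "\<exists>P. \<forall>a. D a = poly P a"
  proof -
    obtain P where P: "\<And>k a. rothe q k a = poly (P k) a"
      using rothe_polynomial by metis
    have "\<forall>a. D a = poly ((\<Sum>k\<le>Suc n. smult (rothe q (Suc n - k) b) (P k)) - pcompose (P (Suc n)) [:b, 1:]) a"
      unfolding D_def P by (simp add: poly_sum poly_pcompose mult.commute add.commute)
    then show ?thesis by blast
  qed
  then obtain P where P: "\<And>a. D a = poly P a" by blast
  have "range real \<subseteq> {a. poly P a = 0}"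
    using nat P by auto
  then have "infinite {a. poly P a = 0}"
    using infinite_super range_inj_infinite inj_of_nat by blast
  then have "P = 0"
    using poly_roots_finite by blast
  then have "D a = 0"
    using P by simp
  then show ?case by (simp add: D_def)
qed

section \<open>Bounds on the coefficients, uniform in \<open>r\<close>\<close>

text \<open>The left side is one term of the binomial series of \<open>(1 - x) powr (- c)\<close>,
  all of whose terms are nonnegative.\<close>

lemma pochhammer_fact_bound:
  fixes c x :: real
  assumes "c > 0" "0 < x" "x < 1"
  shows "pochhammer c m / fact m * x ^ m \<le> (1 - x) powr (- c)"
proof -
  have eq: "((- c) gchoose k) * (- x) ^ k = pochhammer c k / fact k * x ^ k" for k
  proof -
    have "(- 1 :: real) ^ k * (- 1) ^ k = 1" by (simp flip: power_mult_distrib)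
    then show ?thesis
      unfolding gbinomial_pochhammer power_minus[of x] by simp
  qed
  have "(\<lambda>k. ((- c) gchoose k) * (- x) ^ k) sums (1 + (- x)) powr (- c)"
    by (rule gen_binomial_real) (use assms in auto)
  then have S: "(\<lambda>k. pochhammer c k / fact k * x ^ k) sums (1 - x) powr (- c)"
    unfolding eq by simp
  have "(\<Sum>k\<in>{m}. pochhammer c k / fact k * x ^ k) \<le> (1 - x) powr (- c)"
    unfolding sums_unique[OF S]
    by (rule sum_le_suminf[OF sums_summable[OF S]])
       (use assms pochhammer_pos[of c] in \<open>auto intro!: mult_nonneg_nonneg divide_nonneg_nonneg less_imp_le\<close>)
  then show ?thesis by simp
qed

text \<open>Splitting off \<open>a / Suc k\<close> leaves a binomial series coefficient. The point
  \<open>x\<close> stays free so that it can be optimised later.\<close>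

lemma rothe_bound:
  assumes "0 < x" "x < 1" "a + real (Suc k) * q + 1 > 0"
  shows "\<bar>rothe q (Suc k) a\<bar> * x ^ k \<le> \<bar>a\<bar> / real (Suc k) * (1 - x) powr (- (a + real (Suc k) * q + 1))"
proof -
  let ?c = "a + real (Suc k) * q + 1"
  have "\<bar>rothe q (Suc k) a\<bar> * x ^ k = \<bar>a\<bar> / real (Suc k) * (pochhammer ?c k / fact k * x ^ k)"
    using pochhammer_pos[OF assms(3), of k]
    by (simp add: rothe_Suc abs_mult field_simps del: of_nat_Suc)
  also have "\<dots> \<le> \<bar>a\<bar> / real (Suc k) * (1 - x) powr (- ?c)"
    by (intro mult_left_mono pochhammer_fact_bound assms) auto
  finally show ?thesis .
qed

text \<open>The radius of convergence \<open>(r / (r + 1)) * (r + 1) powr (- 1 / r)\<close> is smallest for \<open>r = 2\<close>, where its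
  inverse is \<open>crit\<close>. The number \<open>3 / 8\<close> separates \<open>1 / e\<close> from \<open>1 / crit\<close>.\<close>

definition crit :: real where "crit = 3 / 2 * sqrt 3"

text \<open>Common ratio of all geometric majorants below: growth of the coefficients times the
  bound on \<open>s\<close> and \<open>t\<close>.\<close>

definition rate :: real where "rate = crit * (3 / 8)"

lemma rate_bounds: "0 < rate" "rate < 1"
proof -
  \<comment> \<open>\<open>rate\<close> equals \<open>9 / 16 * sqrt 3\<close>, and
    \<open>256 / 81\<close> exceeds 3.\<close>
  have "sqrt 3 < 16 / 9"
    by (rule real_less_lsqrt) (auto simp: power2_eq_square)
  then show "0 < rate" "rate < 1" by (auto simp: rate_def crit_def)
qed

text \<open>Used for \<open>y = 3\<close> and \<open>y = r + 1\<close>; in both cases equality holds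
  at \<open>r = 2\<close>.\<close>

lemma powr_inverse_le_sqrt_3:
  assumes "r \<ge> 2" "y > 0" "y\<^sup>2 \<le> 3 ^ r"
  shows "y powr (1 / real r) \<le> sqrt 3"
proof -
  have "y\<^sup>2 powr (1 / real r) \<le> (3 ^ r) powr (1 / real r)"
    by (rule powr_mono2) (use assms in auto)
  also have "\<dots> = 3"
    using assms(1) by (simp add: powr_powr flip: powr_realpow)
  also have "y\<^sup>2 powr (1 / real r) = (y powr (1 / real r))\<^sup>2"
    using assms(2) by (simp add: powr_powr mult.commute flip: powr_numeral)
  finally show ?thesis
    by (rule real_le_rsqrt)
qed

lemma square_le_3_power:
  assumes "r \<ge> 2"
  shows "(real r + 1)\<^sup>2 \<le> 3 ^ r"
  using assms
proof (induction r rule: dec_induct)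
  case base
  then show ?case by simp
next
  case (step k)
  have "1 \<le> real k * 2 + real k * (real k * 2)"
    by (rule add_increasing2) (use step.hyps in simp_all)
  then have "(real (Suc k) + 1)\<^sup>2 \<le> 3 * (real k + 1)\<^sup>2"
    by (simp add: power2_eq_square algebra_simps)
  with step.IH show ?case by simp
qed

lemma three_powr_le: "r \<ge> 2 \<Longrightarrow> 3 powr (1 / real r) \<le> sqrt 3"
  using power_increasing[of 2 r "3::real"] by (intro powr_inverse_le_sqrt_3) auto

lemma crit_bound:
  assumes "r \<ge> 2"
  shows "(real r + 1) / real r * (real r + 1) powr (1 / real r) \<le> crit"
proof -
  have "(real r + 1) / real r \<le> 3 / 2"
    using assms by (simp add: field_simps)
  moreover have "(real r + 1) powr (1 / real r) \<le> sqrt 3"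
    by (intro powr_inverse_le_sqrt_3 square_le_3_power assms) auto
  ultimately show ?thesis
    unfolding crit_def by (intro mult_mono) auto
qed

text \<open>Choosing \<open>x = 2 / 3\<close> in \<open>rothe_bound\<close> works for all \<open>r\<close> at once but loses a factor exponential in \<open>r\<close>
  at \<open>k = r\<close>; the tail therefore needs the optimal \<open>x = r / (r + 1)\<close>.\<close>

lemma rothe_crit_bound:
  assumes "r \<ge> 2" "a \<ge> - 1 / real r"
  shows "\<bar>rothe (1 / real r) (Suc k) a\<bar> \<le> \<bar>a\<bar> / real (Suc k) * 3 powr (a + 1 / real r + 1) * crit ^ k"
proof -
  let ?q = "1 / real r"
  have pos: "a + real (Suc k) * ?q + 1 > 0"
    using assms by (simp add: add_divide_distrib) (smt (verit) divide_nonneg_nonneg of_nat_0_le_iff)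
  have 1: "\<bar>rothe ?q (Suc k) a\<bar> * (2 / 3) ^ k \<le> \<bar>a\<bar> / real (Suc k) * (1 / 3) powr (- (a + real (Suc k) * ?q + 1))"
    using rothe_bound[of "2 / 3" a k ?q] pos by simp
  have "(1 / 3) powr (- (a + real (Suc k) * ?q + 1)) = 3 powr (a + real (Suc k) * ?q + 1)"
    by (subst powr_minus) (simp add: powr_divide)
  \<comment> \<open>Exactly \<open>k\<close> factors \<open>3 powr ?q\<close> are separated, to be
    paired with \<open>(3 / 2) ^ k\<close> into \<open>crit ^ k\<close>.\<close>
  also have "\<dots> = 3 powr (a + ?q + 1) * (3 powr ?q) ^ k"
    by (simp add: powr_powr add_divide_distrib flip: powr_realpow powr_add) (simp add: add_ac)
  also have "\<dots> \<le> 3 powr (a + ?q + 1) * sqrt 3 ^ k"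
    by (intro mult_left_mono power_mono three_powr_le assms) auto
  finally have 2: "(1 / 3) powr (- (a + real (Suc k) * ?q + 1)) \<le> 3 powr (a + ?q + 1) * sqrt 3 ^ k" .
  have "\<bar>rothe ?q (Suc k) a\<bar> = (\<bar>rothe ?q (Suc k) a\<bar> * (2 / 3) ^ k) * (3 / 2) ^ k"
    by (simp add: mult.assoc flip: power_mult_distrib)
  also have "\<dots> \<le> (\<bar>a\<bar> / real (Suc k) * (3 powr (a + ?q + 1) * sqrt 3 ^ k)) * (3 / 2) ^ k"
    by (intro mult_right_mono order_trans[OF 1] mult_left_mono 2) auto
  also have "\<dots> = \<bar>a\<bar> / real (Suc k) * 3 powr (a + ?q + 1) * crit ^ k"
    unfolding crit_def power_mult_distrib by (simp only: mult_ac)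
  finally show ?thesis .
qed

text \<open>At this index the exponent of \<open>1 / (1 - x)\<close> is only
  \<open>2 + m / r\<close>. The resulting \<open>(r + 1)\<^sup>2\<close> is absorbed by the
  prefactor \<open>1 / (r * (r + m + 1))\<close>, and \<open>(1 / x) ^ r\<close> is
  \<open>(1 + 1 / r) ^ r\<close>, at most 3. So no factor exponential in \<open>r\<close>
  remains.\<close>

lemma rothe_tail_bound:
  assumes "r \<ge> 2"
  shows "\<bar>rothe (1 / real r) (Suc (r + m)) (- 1 / real r)\<bar> \<le> 5 * crit ^ m"
proof -
  let ?q = "1 / real r"
  define x where "x = real r / (real r + 1)"
  have r: "real r \<ge> 2" using assms by simp
  have x: "0 < x" "x < 1" "1 - x = 1 / (real r + 1)" using r by (auto simp: x_def field_simps)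
  let ?k = "r + m"
  have e: "- ?q + real (Suc ?k) * ?q + 1 = 2 + real m * ?q"
    using r by (simp add: field_simps)
  have "\<bar>rothe ?q (Suc ?k) (- ?q)\<bar> * x ^ ?k \<le> \<bar>- ?q\<bar> / real (Suc ?k) * (1 - x) powr (- (2 + real m * ?q))"
    using rothe_bound[of x "- ?q" ?k ?q] x unfolding e by (simp add: add_pos_nonneg)
  also have "(1 - x) powr (- (2 + real m * ?q)) = (real r + 1) powr (2 + real m * ?q)"
    unfolding x(3) using r by (subst powr_minus) (simp add: powr_divide)
  also have "\<dots> = (real r + 1)\<^sup>2 * ((real r + 1) powr ?q) ^ m"
  proof -
    have "(real r + 1) powr (real m * ?q) = ((real r + 1) powr ?q) powr real m"
      by (simp add: powr_powr)
    then show ?thesis using r by (simp add: powr_add powr_realpow)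
  qed
  finally have 1: "\<bar>rothe ?q (Suc ?k) (- ?q)\<bar> * x ^ ?k
      \<le> ?q / real (Suc ?k) * ((real r + 1)\<^sup>2 * ((real r + 1) powr ?q) ^ m)"
    by simp
  have "(1 / x) ^ r = (1 + 1 / real r) ^ r"
    using r by (simp add: x_def field_simps)
  also have "\<dots> \<le> exp (1 / real r) ^ r"
    by (intro power_mono exp_ge_add_one_self) (use r in auto)
  also have "\<dots> = exp 1"
    using r by (simp flip: exp_of_nat_mult)
  also have "\<dots> \<le> 3" by (rule exp_le)
  finally have 2: "(1 / x) ^ r \<le> 3" .
  have "?q / real (Suc ?k) * (real r + 1)\<^sup>2 \<le> ?q / (real r + 1) * (real r + 1)\<^sup>2"
    by (intro mult_right_mono divide_left_mono) (use r in auto)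
  also have "\<dots> = 1 + 1 / real r"
    using r by (simp add: power2_eq_square) (simp add: add_divide_distrib)
  also have "\<dots> \<le> 3 / 2" using r by (simp add: field_simps)
  finally have 3: "?q / real (Suc ?k) * (real r + 1)\<^sup>2 \<le> 3 / 2" .
  have "\<bar>rothe ?q (Suc ?k) (- ?q)\<bar> = (\<bar>rothe ?q (Suc ?k) (- ?q)\<bar> * x ^ ?k) * (1 / x) ^ ?k"
    using x by (simp add: mult.assoc flip: power_mult_distrib)
  also have "\<dots> \<le> (?q / real (Suc ?k) * ((real r + 1)\<^sup>2 * ((real r + 1) powr ?q) ^ m)) * (1 / x) ^ ?k"
    by (intro mult_right_mono 1) (use x in auto)
  also have "\<dots> = (?q / real (Suc ?k) * (real r + 1)\<^sup>2) * (1 / x) ^ r * (1 / x * (real r + 1) powr ?q) ^ m"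
    unfolding power_add power_mult_distrib by (simp only: mult_ac)
  also have "\<dots> \<le> 3 / 2 * 3 * crit ^ m"
  proof (intro mult_mono power_mono 2 3)
    show "1 / x * (real r + 1) powr ?q \<le> crit"
      using crit_bound[OF assms] by (simp add: x_def)
  qed (use r x in \<open>auto simp: crit_def\<close>)
  also have "\<dots> \<le> 5 * crit ^ m" by (simp add: crit_def)
  finally show ?thesis by simp
qed

section \<open>The generating series and its functional equations\<close>

lemma rothe_summable:
  assumes "r \<ge> 2" "a \<ge> - 1 / real r" "0 \<le> s" "s \<le> 3 / 8"
  shows "summable (\<lambda>k. norm (rothe (1 / real r) k a * s ^ k))"
proof -
  let ?K = "\<bar>a\<bar> * 3 powr (a + 1 / real r + 1)"
  have bound: "norm (norm (rothe (1 / real r) (Suc k) a * s ^ Suc k)) \<le> ?K * rate ^ k" for k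
  proof -
    have "\<bar>a\<bar> / real (Suc k) \<le> \<bar>a\<bar>" by (simp add: divide_le_eq mult_le_cancel_left1)
    then have "\<bar>rothe (1 / real r) (Suc k) a\<bar> \<le> \<bar>a\<bar> * 3 powr (a + 1 / real r + 1) * crit ^ k"
      by (intro order_trans[OF rothe_crit_bound] assms mult_right_mono) (auto simp: crit_def)
    \<comment> \<open>One factor \<open>s\<close>, at most 1, is given away to match the exponent of
      \<open>crit ^ k\<close>.\<close>
    moreover have "s ^ Suc k \<le> (3 / 8) ^ k"
    proof -
      have "s ^ Suc k \<le> s ^ k" using assms by (intro power_decreasing) auto
      also have "\<dots> \<le> (3 / 8) ^ k" using assms by (intro power_mono) auto
      finally show ?thesis .
    qed
    ultimately have "\<bar>rothe (1 / real r) (Suc k) a\<bar> * s ^ Suc k \<le> (?K * crit ^ k) * (3 / 8) ^ k"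
      by (intro mult_mono) (use assms in \<open>auto simp: crit_def\<close>)
    then show ?thesis
      using assms unfolding rate_def power_mult_distrib by (simp add: abs_mult mult_ac)
  qed
  have "summable (\<lambda>k. ?K * rate ^ k)"
    by (intro summable_mult summable_geometric) (use rate_bounds in simp)
  then have "summable (\<lambda>k. norm (rothe (1 / real r) (Suc k) a * s ^ Suc k))"
    using bound by (rule summable_comparison_test'[where N = 0])
  then show ?thesis by (subst (asm) summable_Suc_iff)
qed

text \<open>The series \<open>G a\<close> of the overview: the \<open>a\<close>-th power of the
  generalized binomial series with parameter \<open>1 + 1 / r\<close>.\<close>

definition rothe_sum :: "nat \<Rightarrow> real \<Rightarrow> real \<Rightarrow> real" where
  "rothe_sum r a s = (\<Sum>k. rothe (1 / real r) k a * s ^ k)"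

context
  fixes r :: nat and s :: real
  assumes r: "r \<ge> 2" and s: "0 \<le> s" "s \<le> 3 / 8"
begin

lemma rothe_sum_add:
  assumes "a \<ge> - 1 / real r" "b \<ge> - 1 / real r"
  shows "rothe_sum r (a + b) s = rothe_sum r a s * rothe_sum r b s"
proof -
  have "rothe_sum r a s * rothe_sum r b s =
      (\<Sum>n. \<Sum>k\<le>n. (rothe (1 / real r) k a * s ^ k) * (rothe (1 / real r) (n - k) b * s ^ (n - k)))"
    unfolding rothe_sum_def by (intro Cauchy_product rothe_summable r s assms)
  also have "\<dots> = (\<Sum>n. (\<Sum>k\<le>n. rothe (1 / real r) k a * rothe (1 / real r) (n - k) b) * s ^ n)"
    unfolding sum_distrib_right
    by (intro suminf_cong sum.cong) (auto simp: mult_ac simp flip: power_add)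
  also have "\<dots> = rothe_sum r (a + b) s"
    unfolding rothe_hagen rothe_sum_def ..
  finally show ?thesis ..
qed

lemma rothe_sum_0: "rothe_sum r 0 s = 1"
proof -
  have "rothe_sum r 0 s = (\<Sum>k\<in>{0}. rothe (1 / real r) k 0 * s ^ k)"
    unfolding rothe_sum_def by (rule suminf_finite) (auto simp: rothe_def)
  then show ?thesis by simp
qed

lemma rothe_sum_1: "rothe_sum r 1 s = 1 + s * rothe_sum r (1 + 1 / real r) s"
proof -
  let ?q = "1 / real r"
  have S: "summable (\<lambda>k. rothe ?q k 1 * s ^ k)" and T: "summable (\<lambda>k. rothe ?q k (1 + ?q) * s ^ k)"
    by (rule summable_norm_cancel, rule rothe_summable[OF r _ s],
        use order_trans[of _ 0 "1 / real r"] in simp)+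
  \<comment> \<open>Pascal's rule at \<open>a = 0\<close>, where the subtracted coefficient
    vanishes.\<close>
  have "rothe ?q (Suc k) 1 = rothe ?q k (1 + ?q)" for k
    using rothe_difference[of ?q k 0] by (simp add: rothe_Suc)
  then have "(\<Sum>k. rothe ?q (Suc k) 1 * s ^ Suc k) = s * rothe_sum r (1 + ?q) s"
    unfolding rothe_sum_def by (subst suminf_mult[OF T, symmetric]) (simp add: mult_ac)
  then show ?thesis
    using suminf_split_head[OF S] by (simp add: rothe_sum_def)
qed

lemma rothe_sum_power: "rothe_sum r (real j * (1 / real r)) s = rothe_sum r (1 / real r) s ^ j"
proof (induction j)
  case 0
  then show ?case by (simp add: rothe_sum_0)
next
  case (Suc j)
  have "rothe_sum r (1 / real r + real j * (1 / real r)) s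
      = rothe_sum r (1 / real r) s * rothe_sum r (real j * (1 / real r)) s"
    by (rule rothe_sum_add) (auto intro: order_trans[of _ 0])
  moreover have "real (Suc j) * (1 / real r) = 1 / real r + real j * (1 / real r)"
    by (simp add: add_divide_distrib)
  ultimately show ?case using Suc by (simp only: power_Suc)
qed

text \<open>Taking \<open>r\<close> and \<open>r + 1\<close> copies of \<open>1 / r\<close> turns
  \<open>rothe_sum_1\<close> into an algebraic equation for a single series.\<close>

lemma rothe_sum_trinomial:
  "rothe_sum r (1 / real r) s ^ r = 1 + s * rothe_sum r (1 / real r) s ^ Suc r"
proof -
  have "rothe_sum r (1 / real r) s ^ r = rothe_sum r 1 s"
    using r by (simp flip: rothe_sum_power)
  moreover have "rothe_sum r (1 / real r) s ^ Suc r = rothe_sum r (1 + 1 / real r) s"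
    using r unfolding rothe_sum_power[symmetric] by (simp add: add_divide_distrib add.commute)
  ultimately show ?thesis by (simp add: rothe_sum_1)
qed

lemma rothe_sum_inverse: "rothe_sum r (- 1 / real r) s * rothe_sum r (1 / real r) s = 1"
  using rothe_sum_add[of "- 1 / real r" "1 / real r"] by (simp add: rothe_sum_0)

end


section \<open>Selecting the right root of the trinomial equation\<close>

lemma rothe_sum_nonneg_mono:
  assumes "r \<ge> 2" "0 \<le> s1" "s1 \<le> s2" "s2 \<le> 3 / 8"
  shows "0 \<le> rothe_sum r (1 / real r) s1" "rothe_sum r (1 / real r) s1 \<le> rothe_sum r (1 / real r) s2"
proof -
  let ?q = "1 / real r"
  have nonneg: "0 \<le> rothe ?q k ?q" for k
  proof -
    have "0 < ?q + real k * ?q + 1" by (intro add_nonneg_pos add_nonneg_nonneg) auto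
    then have "0 < pochhammer (?q + real k * ?q + 1) (k - 1)" by (rule pochhammer_pos)
    then show ?thesis by (auto simp: rothe_def)
  qed
  have S: "summable (\<lambda>k. rothe ?q k ?q * s ^ k)" if "0 \<le> s" "s \<le> 3 / 8" for s
    by (rule summable_norm_cancel, rule rothe_summable[OF assms(1) _ that], rule order_trans[of _ 0]) auto
  have "summable (\<lambda>k. rothe ?q k ?q * s1 ^ k)" "summable (\<lambda>k. rothe ?q k ?q * s2 ^ k)"
    using assms by (auto intro!: S)
  then show "0 \<le> rothe_sum r ?q s1" "rothe_sum r ?q s1 \<le> rothe_sum r ?q s2"
    unfolding rothe_sum_def using assms nonneg
    by (auto intro!: suminf_nonneg suminf_le mult_left_mono power_mono)
qed

text \<open>Bernoulli's inequality for \<open>v / w\<close> replaces a derivative argument; the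
  lower bound on \<open>v\<close> enters as \<open>r * (1 - v) \<le> w\<close>.\<close>

lemma trinomial_antimono:
  fixes v w :: real
  assumes "real r / (real r + 1) \<le> v" "v < w" "w < 1"
  shows "w ^ r * (1 - w) \<le> v ^ r * (1 - v)"
proof -
  have v: "0 \<le> v" using order_trans[OF _ assms(1), of 0] by simp
  then have w: "0 < w" using assms(2) by simp
  have 1: "1 + real r * (v / w - 1) \<le> (v / w) ^ r"
    using Bernoulli_inequality[of "v / w - 1" r] v w by simp
  have "real r * (1 - v) \<le> w"
    using assms by (simp add: field_simps)
  then have "(w - v) * (real r * (1 - v)) \<le> (w - v) * w"
    using assms by (intro mult_left_mono) auto
  then have "1 - w \<le> (1 + real r * (v / w - 1)) * (1 - v)"
    using w by (simp add: field_simps)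
  also have "\<dots> \<le> (v / w) ^ r * (1 - v)"
    using 1 assms by (intro mult_right_mono) auto
  finally have "w ^ r * (1 - w) \<le> w ^ r * ((v / w) ^ r * (1 - v))"
    using w by (intro mult_left_mono) auto
  then show ?thesis
    using w by (simp add: power_divide)
qed

text \<open>The equation \<open>v = s * (1 - v) powr (- 1 / r)\<close> freed of its fractional
  power; it is \<open>rothe_sum_trinomial\<close> multiplied by \<open>s ^ r\<close>.\<close>

lemma rothe_sum_root:
  assumes "r \<ge> 2" "0 < s" "s \<le> 3 / 8"
  defines "v \<equiv> s * rothe_sum r (1 / real r) s"
  shows "0 < v" "v ^ r * (1 - v) = s ^ r"
proof -
  let ?b = "rothe_sum r (1 / real r) s"
  have "0 \<le> ?b" using rothe_sum_nonneg_mono(1)[of r s s] assms by simp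
  moreover have "?b \<noteq> 0" using rothe_sum_inverse[of r s] assms by auto
  ultimately show "0 < v" using assms by (simp add: v_def)
  have "?b ^ r = 1 + s * ?b ^ Suc r"
    using rothe_sum_trinomial[of r s] assms by simp
  then have "s ^ r * (?b ^ r - s * ?b ^ Suc r) = s ^ r" by simp
  moreover have "v ^ r * (1 - v) = s ^ r * (?b ^ r - s * ?b ^ Suc r)"
    by (simp add: v_def power_mult_distrib algebra_simps)
  ultimately show "v ^ r * (1 - v) = s ^ r" by simp
qed

text \<open>The function \<open>v \<mapsto> v ^ r * (1 - v)\<close> increases only up to \<open>v = r / (r + 1)\<close>. As the root grows with \<open>s\<close>
  on the whole of \<open>(0, 3 / 8]\<close>, it stays on the increasing branch.\<close>

lemma rothe_sum_root_small:
  assumes "r \<ge> 2" "0 < s" "s < 3 / 8"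
  shows "s * rothe_sum r (1 / real r) s < real r / (real r + 1)"
proof (rule ccontr)
  define v where "v s = s * rothe_sum r (1 / real r) s" for s
  assume "\<not> ?thesis"
  then have ge: "real r / (real r + 1) \<le> v s" by (simp add: v_def)
  have v: "0 < v u" "v u ^ r * (1 - v u) = u ^ r" if "0 < u" "u \<le> 3 / 8" for u
    using rothe_sum_root[OF assms(1) that] by (simp_all add: v_def)
  have "0 < v s" using v(1)[of s] assms by simp
  then have "0 < rothe_sum r (1 / real r) s" using assms by (simp add: v_def zero_less_mult_iff)
  then have "v s < 3 / 8 * rothe_sum r (1 / real r) s"
    using assms by (simp add: v_def)
  also have "\<dots> \<le> v (3 / 8)"
    unfolding v_def using rothe_sum_nonneg_mono(2)[of r s "3 / 8"] assms by simp
  finally have less: "v s < v (3 / 8)" .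
  have "0 < v (3 / 8) ^ r * (1 - v (3 / 8))"
    by (subst v(2)) auto
  then have "v (3 / 8) < 1"
    using v(1)[of "3 / 8"] by (simp add: zero_less_mult_iff)
  then have "(3 / 8) ^ r \<le> s ^ r"
    using trinomial_antimono[OF ge less] v(2)[of s] v(2)[of "3 / 8"] assms by simp
  moreover have "s ^ r < (3 / 8) ^ r"
    using assms by (intro power_strict_mono) auto
  ultimately show False by simp
qed

section \<open>The polynomial equation and its positive solution\<close>

lemma is_pos_sol_unique:
  assumes "r \<ge> 1" "is_pos_sol n r x" "is_pos_sol n r y"
  shows "x = y"
proof -
  have "\<not> u < v" if "is_pos_sol n r u" "is_pos_sol n r v" for u v
  proof
    assume "u < v"
    then have "(\<Sum>j=1..r. u ^ j) < (\<Sum>j=1..r. v ^ j)"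
      using that assms(1) by (intro sum_strict_mono power_strict_mono) (auto simp: is_pos_sol_def)
    then show False using that by (simp add: is_pos_sol_def)
  qed
  with assms(2,3) show ?thesis by (meson linorder_neqE_linordered_idom)
qed

text \<open>Multiplying by \<open>x - 1\<close> telescopes the sum but adds the root 1, which must
  be excluded.\<close>

lemma is_pos_solI:
  assumes "x > 0" "x \<noteq> 1" "(real n + 1) * x = x ^ Suc r + real n"
  shows "is_pos_sol n r x"
proof -
  have "(x - 1) * (\<Sum>j=1..r. x ^ j) = x ^ Suc r - x"
    by (induction r) (simp_all add: algebra_simps)
  with assms(3) have "(x - 1) * (\<Sum>j=1..r. x ^ j) = (x - 1) * real n"
    by (simp add: algebra_simps)
  with assms show ?thesis by (simp add: is_pos_sol_def)
qed

section \<open>Gamma quotients and elementary estimates\<close>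

text \<open>At \<open>a = - q\<close> the rising product starts at \<open>(N - 1) * q + 1\<close>,
  so it is a quotient of Gamma values. The recurrence for the denominator brings in
  \<open>N - 1\<close> and cancels \<open>q\<close>.\<close>

lemma rothe_Gamma:
  assumes "N \<ge> 2" "q > 0"
  shows "rothe q N (- q) = - (Gamma (real N + (real N - 1) * q)
           / ((real N - 1) * Gamma (real N + 1) * Gamma ((real N - 1) * q)))"
proof -
  obtain k where N: "N = Suc k" and k: "k \<ge> 1" using assms(1) by (cases N) auto
  let ?z = "real k * q"
  have z: "?z > 0" using k assms by simp
  have "pochhammer (?z + 1) k = Gamma (?z + 1 + real k) / Gamma (?z + 1)"
    using z by (intro pochhammer_Gamma) (auto elim!: nonpos_Ints_cases)
  moreover have "Gamma (?z + 1) = ?z * Gamma ?z"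
    using z by (intro Gamma_plus1) (auto elim!: nonpos_Ints_cases)
  moreover have "Gamma (real N + 1) = fact N"
    using Gamma_fact[of N, where ?'a = real] by (simp add: add.commute)
  moreover have "- q + real (Suc k) * q + 1 = ?z + 1" by (simp add: algebra_simps)
  moreover have "real N + (real N - 1) * q = ?z + 1 + real k" "(real N - 1) * q = ?z"
    by (simp_all add: N)
  ultimately show ?thesis
    using assms(2) k by (simp add: rothe_Suc N del: of_nat_Suc fact_Suc) (simp add: field_simps)
qed


text \<open>First order suffices for negative exponents. The power \<open>q\<close> needs second
  order, because its error is later divided by \<open>t\<close>.\<close>

lemma powr_one_plus_bounds:
  fixes d a q :: real
  assumes "0 \<le> d" "d \<le> 1" "a \<ge> 0" "0 \<le> q" "q \<le> 1"
  shows "(1 + d) powr (- a) \<le> 1" "1 - a * d \<le> (1 + d) powr (- a)"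
    and "\<bar>(1 + d) powr q - 1 - q * d\<bar> \<le> d\<^sup>2"
proof -
  have "(1 + d) powr (- a) \<le> (1 + d) powr 0"
    by (rule powr_mono) (use assms in auto)
  then show "(1 + d) powr (- a) \<le> 1" using assms by simp
  have "1 - a * d \<le> 1 - a * ln (1 + d)"
    using assms by (intro diff_left_mono mult_left_mono ln_add_one_self_le_self) auto
  also have "\<dots> \<le> exp (- (a * ln (1 + d)))"
    using exp_ge_add_one_self[of "- (a * ln (1 + d))"] by simp
  also have "\<dots> = (1 + d) powr (- a)"
    using assms by (simp add: powr_def)
  finally show "1 - a * d \<le> (1 + d) powr (- a)" .
  have "1 + q * (d - d\<^sup>2) \<le> 1 + q * ln (1 + d)"
    using assms by (intro add_left_mono mult_left_mono ln_one_plus_pos_lower_bound) auto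
  also have "\<dots> \<le> (1 + d) powr q"
    using assms exp_ge_add_one_self[of "q * ln (1 + d)"] by (simp add: powr_def)
  finally have "1 + q * (d - d\<^sup>2) \<le> (1 + d) powr q" .
  moreover have "q * d\<^sup>2 \<le> d\<^sup>2"
    using assms by (intro mult_left_le_one_le) auto
  moreover have "(1 + d) powr q \<le> 1 + q * d"
  proof -
    \<comment> \<open>Convexity of \<open>exp\<close> between 0 and \<open>ln (1 + d)\<close>, with
      weight \<open>q\<close>.\<close>
    have "exp ((1 - q) *\<^sub>R 0 + q *\<^sub>R ln (1 + d)) \<le> (1 - q) * exp 0 + q * exp (ln (1 + d))"
      using assms by (intro convex_onD[OF exp_convex]) auto
    then show ?thesis using assms by (simp add: powr_def algebra_simps)
  qed
  ultimately show "\<bar>(1 + d) powr q - 1 - q * d\<bar> \<le> d\<^sup>2"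
    by (auto simp: abs_le_iff algebra_simps)
qed

lemma exp_minus_1_less: "exp (- 1) < (3 / 8 :: real)"
proof -
  \<comment> \<open>The quadratic Taylor bound at 1 gives only \<open>5 / 2\<close>, below the
    required \<open>8 / 3\<close>; at \<open>1 / 4\<close> it gives \<open>41 / 32\<close>, whose
    fourth power suffices.\<close>
  have "1 + 1 / 4 + (1 / 4)\<^sup>2 / 2 \<le> exp (1 / 4 :: real)"
    by (rule exp_lower_Taylor_quadratic) simp
  then have "(41 / 32) ^ 4 \<le> exp (1 / 4 :: real) ^ 4"
    by (intro power_mono) (simp_all add: power2_eq_square)
  moreover have "exp (1 / 4 :: real) ^ 4 = exp 1"
    by (simp flip: exp_of_nat_mult)
  ultimately have "8 / 3 < exp (1 :: real)"
    by (simp add: power_divide)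
  then show ?thesis by (simp add: exp_minus field_simps)
qed

section \<open>The expansion with an explicit error constant\<close>

lemma is_pos_sol_expansion:
  fixes n r :: nat
  assumes r: "2 \<le> r" and rn: "real r \<le> ln (real n)"
  defines "q \<equiv> 1 / real r" and "d \<equiv> 1 / real n" and "t \<equiv> real n powr (- (1 / real r))"
  shows "\<exists>x. is_pos_sol n r x \<and>
    \<bar>x - (1 / t - q + (\<Sum>N=2..r. rothe q N (- q) * t ^ (N - 1)) + q * d / t)\<bar> \<le> (2 + 8 / (1 - rate)) * d"
proof -
  have n: "real n > 0"
    using r rn by (cases "n = 0") auto
  have q: "0 < q" "q \<le> 1 / 2" using r by (auto simp: q_def field_simps)
  have d: "0 < d" using n by (simp add: d_def)
  have t: "0 < t" using n by (simp add: t_def)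
  have tr: "t ^ r = d"
    using n r t by (simp add: t_def d_def powr_powr powr_minus field_simps flip: powr_realpow)
  have "t = exp (- (ln (real n) / real r))"
    using n by (simp add: t_def powr_def)
  also have "\<dots> \<le> exp (- 1)"
    using r rn by (simp add: field_simps)
  finally have t38: "t < 3 / 8" using exp_minus_1_less by simp
  have "1 + real r \<le> exp (real r)" by (rule exp_ge_add_one_self)
  also have "\<dots> \<le> exp (ln (real n))" using rn by simp
  finally have nr: "1 + real r \<le> real n" using n by simp
  have d1: "d \<le> 1" and dr: "d < 1 / real r"
    using nr r by (auto simp: d_def field_simps)
  define s where "s = t * (1 + d) powr (- 1 - q)"
  have s: "0 < s" using t d by (simp add: s_def)
  have "(1 + d) powr (- (1 + q)) \<le> 1"
    using d d1 q by (intro powr_one_plus_bounds) auto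
  then have st: "s \<le> t" using t by (simp add: s_def)
  have s38: "s < 3 / 8" using st t38 by simp
  have w: "s ^ j / (1 + d) = t ^ j * (1 + d) powr (- ((1 + q) * real j + 1))" for j
  proof -
    have "((1 + d) powr (- 1 - q)) ^ j = (1 + d) powr (- ((1 + q) * real j))"
      using d by (simp add: powr_powr algebra_simps flip: powr_realpow)
    moreover have "(1 + d) powr (- ((1 + q) * real j + 1)) = (1 + d) powr (- ((1 + q) * real j)) / (1 + d)"
      using d by (simp add: powr_diff flip: powr_minus_divide)
    ultimately show ?thesis by (simp add: s_def power_mult_distrib)
  qed
  define v where "v = s * rothe_sum r q s"
  define x where "x = 1 / ((1 + d) * v)"
  have v: "0 < v" "v ^ r * (1 - v) = s ^ r" "v < real r / (real r + 1)"
    using rothe_sum_root[OF r s] rothe_sum_root_small[OF r s s38] s38 by (auto simp: v_def q_def)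
  have sol: "is_pos_sol n r x"
  proof (rule is_pos_solI)
    show "x > 0" using v d by (simp add: x_def)
    \<comment> \<open>Staying on the increasing branch, together with \<open>d < 1 / r\<close>,
      forces \<open>x > 1\<close>.\<close>
    have "(1 + d) * v < (1 + 1 / real r) * (real r / (real r + 1))"
      using v d dr by (intro mult_strict_mono) auto
    also have "(1 + 1 / real r) * (real r / (real r + 1)) = (real r + 1) / (real r + 1)"
      using r by (simp add: distrib_right add_divide_distrib)
    also have "\<dots> = 1" by simp
    finally show "x \<noteq> 1" by (auto simp: x_def)
    \<comment> \<open>The exponent \<open>- 1 - q\<close> in \<open>s\<close> is chosen for this:
      substituting \<open>x\<close> then turns the equation for \<open>v\<close> into
      \<open>(1 + d) * x - 1 = d * x ^ Suc r\<close>, which is the trinomial divided by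
      \<open>n\<close>.\<close>
    have "s ^ r = d / (1 + d) ^ Suc r"
    proof -
      have "s ^ r = (1 + d) * (t ^ r * (1 + d) powr (- ((1 + q) * real r + 1)))"
        using w[of r] d by (simp add: field_simps)
      also have "(1 + q) * real r + 1 = real (r + 2)"
        using r by (simp add: q_def field_simps)
      also have "(1 + d) powr (- real (r + 2)) = 1 / (1 + d) ^ (r + 2)"
        using d by (simp only: powr_minus_divide powr_realpow)
      also have "(1 + d) ^ (r + 2) = (1 + d) * (1 + d) ^ Suc r" by simp
      finally show ?thesis using d tr by (simp del: power_Suc)
    qed
    with v(2) have "v ^ r * (1 - v) * (1 + d) ^ Suc r = d" using d by simp
    then have "v ^ r * (1 - v) * (1 + d) ^ Suc r * x ^ Suc r = d * x ^ Suc r" by simp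
    moreover have "v ^ r * (1 - v) * (1 + d) ^ Suc r * x ^ Suc r = (1 - v) / v"
    proof -
      have "x ^ Suc r = 1 / ((1 + d) ^ Suc r * (v ^ r * v))"
        by (simp add: x_def power_divide power_mult_distrib mult_ac)
      then show ?thesis using v(1) d by (simp del: power_Suc)
    qed
    moreover have "(1 - v) / v = (1 + d) * x - 1"
    proof -
      have "(1 + d) * x = 1 / v" using d by (simp add: x_def)
      then show ?thesis using v(1) by (simp add: diff_divide_distrib)
    qed
    ultimately have "(1 + d) * x - 1 = d * x ^ Suc r" by metis
    moreover have "real n * ((1 + d) * x - 1) = real n * x + (real n * d) * x - real n"
      by (simp add: algebra_simps)
    ultimately have "real n * x + (real n * d) * x - real n = (real n * d) * x ^ Suc r"
      by (simp only: mult.assoc)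
    moreover have "real n * d = 1" using n by (simp add: d_def)
    ultimately show "(real n + 1) * x = x ^ Suc r + real n"
      by (simp add: distrib_right del: power_Suc)
  qed
  define f where "f k = rothe q k (- q) * s ^ k" for k
  have "rothe_sum r (- q) s = 1 / rothe_sum r q s"
  proof -
    have "rothe_sum r (- q) s * rothe_sum r q s = 1"
      using rothe_sum_inverse[OF r, of s] s s38 by (simp add: q_def)
    then show ?thesis by (metis mult_zero_right nonzero_eq_divide_eq zero_neq_one)
  qed
  then have x: "x = rothe_sum r (- q) s / (s * (1 + d))"
    using s d by (simp add: x_def v_def)
  have "summable (\<lambda>k. norm (f k))"
    unfolding f_def q_def using r s s38 by (intro rothe_summable[of r "- (1 / real r)"]) auto
  then have f: "summable f" by (rule summable_norm_cancel)
  have "rothe_sum r (- q) s = (\<Sum>k. f k)"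
    by (simp add: rothe_sum_def f_def q_def)
  also have "\<dots> = (\<Sum>k. f (k + Suc r)) + (\<Sum>k<Suc r. f k)"
    by (rule suminf_split_initial_segment[OF f])
  also have "(\<Sum>k<Suc r. f k) = (\<Sum>k<2. f k) + (\<Sum>k=2..r. f k)"
    using r by (subst sum.atLeastLessThan_concat[of 0 2 "Suc r", symmetric, unfolded atLeast0LessThan])
      (auto simp: atLeastLessThanSuc_atLeastAtMost)
  \<comment> \<open>These two terms produce the leading \<open>1 / t\<close> and the constant
    \<open>- q\<close>.\<close>
  also have "(\<Sum>k<2. f k) = 1 - q * s"
    by (simp add: f_def rothe_Suc eval_nat_numeral)
  finally have split: "rothe_sum r (- q) s = 1 - q * s + (\<Sum>k=2..r. f k) + (\<Sum>k. f (k + Suc r))" by simp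

  \<comment> \<open>The errors come from linearising the leading term (\<open>E0\<close>), from the
    constant term (\<open>E1\<close>), from replacing \<open>s\<close> by \<open>t\<close> in the
    finite sum (\<open>E2\<close>) and from the tail (\<open>E3\<close>). Their bounds in units of
    \<open>d\<close> are 1, 1, \<open>3 / (1 - rate)\<close> and
    \<open>5 / (1 - rate)\<close>.\<close>
  define E0 where "E0 = ((1 + d) powr q - 1 - q * d) / t"
  define E1 where "E1 = q - q / (1 + d)"
  define E2 where "E2 = (\<Sum>N=2..r. rothe q N (- q) * (s ^ (N - 1) / (1 + d) - t ^ (N - 1)))"
  define E3 where "E3 = (\<Sum>k. f (k + Suc r)) / (s * (1 + d))"

  have "x = 1 / (s * (1 + d)) - q / (1 + d) + (\<Sum>k=2..r. f k / (s * (1 + d))) + E3"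
    unfolding x split E3_def using s by (simp add: add_divide_distrib diff_divide_distrib sum_divide_distrib)
  also have "1 / (s * (1 + d)) = (1 + d) powr q / t"
  proof -
    have "(1 + d) powr (- 1 - q) * (1 + d) * (1 + d) powr q = (1 + d) powr (- 1 - q) * (1 + d) powr 1 * (1 + d) powr q"
      using d by simp
    also have "\<dots> = 1"
      using d by (simp only: powr_add[symmetric]) simp
    finally have "(1 + d) powr q = 1 / ((1 + d) powr (- 1 - q) * (1 + d))"
      by (metis mult.commute mult_zero_right nonzero_eq_divide_eq zero_neq_one)
    then show ?thesis by (simp add: s_def mult_ac)
  qed
  also have "(\<Sum>k=2..r. f k / (s * (1 + d))) = (\<Sum>N=2..r. rothe q N (- q) * t ^ (N - 1)) + E2"
    unfolding E2_def sum.distrib[symmetric]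
  proof (rule sum.cong[OF refl])
    fix k assume "k \<in> {2..r}"
    then have "s ^ k = s * s ^ (k - 1)" by (cases k) auto
    then show "f k / (s * (1 + d)) = rothe q k (- q) * t ^ (k - 1) + rothe q k (- q) * (s ^ (k - 1) / (1 + d) - t ^ (k - 1))"
      using s by (simp add: f_def right_diff_distrib)
  qed
  finally have decomp: "x - (1 / t - q + (\<Sum>N=2..r. rothe q N (- q) * t ^ (N - 1)) + q * d / t) = E0 + E1 + E2 + E3"
    by (simp add: E0_def E1_def diff_divide_distrib)

  have E0: "\<bar>E0\<bar> \<le> d"
  proof -
    have "\<bar>E0\<bar> \<le> d\<^sup>2 / t"
      unfolding E0_def abs_divide using powr_one_plus_bounds(3)[of d 0 q] d d1 q t
      by (simp add: divide_right_mono)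
    \<comment> \<open>As \<open>d = t ^ r\<close> with \<open>t < 1\<close>, one of the two factors
      \<open>d\<close> pays for the division by \<open>t\<close>.\<close>
    also have "d \<le> t"
      using power_decreasing[of 1 r t] t t38 r tr by simp
    then have "d\<^sup>2 / t \<le> d"
      using d t by (simp add: power2_eq_square field_simps)
    finally show ?thesis .
  qed
  have E1: "\<bar>E1\<bar> \<le> d"
  proof -
    have "E1 = q * d / (1 + d)" using d by (simp add: E1_def field_simps)
    also have "\<dots> \<le> 1 * d / 1" using d q by (intro frac_le mult_mono) auto
    finally have "E1 \<le> d" by simp
    moreover have "0 \<le> q * d / (1 + d)" using d q by simp
    ultimately show ?thesis using \<open>E1 = q * d / (1 + d)\<close> by simp
  qed
  have geom: "(\<lambda>k. rate ^ k) sums (1 / (1 - rate))"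
    using rate_bounds by (intro geometric_sums) simp
  have E2: "\<bar>E2\<bar> \<le> 3 / (1 - rate) * d"
  proof -
    have "\<bar>rothe q N (- q) * (s ^ (N - 1) / (1 + d) - t ^ (N - 1))\<bar> \<le> 3 * d * rate ^ (N - 1)"
      if range: "N \<in> {2..r}" for N
    proof -
      obtain k where N: "N = Suc k" using range by (cases N) auto
      have "\<bar>rothe q (Suc k) (- q)\<bar> \<le> \<bar>- q\<bar> / real (Suc k) * 3 powr (- q + q + 1) * crit ^ k"
        using rothe_crit_bound[OF r, of "- (1 / real r)" k] by (simp add: q_def)
      then have 1: "\<bar>rothe q (Suc k) (- q)\<bar> \<le> q / real (Suc k) * 3 * crit ^ k"
        using q by simp
      let ?a = "(1 + q) * real k + 1"
      have a: "0 \<le> ?a" using q by simp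
      have "?a \<le> 2 * real k + 1"
        using q by (intro add_right_mono mult_right_mono) auto
      \<comment> \<open>The growth in \<open>Suc k\<close> cancels against \<open>1 / Suc k\<close>
        in the coefficient bound, and \<open>2 * q \<le> 1\<close> absorbs the 2.\<close>
      then have "?a * d \<le> 2 * real (Suc k) * d"
        using d by (intro mult_right_mono) auto
      moreover have "\<bar>(1 + d) powr (- ?a) - 1\<bar> \<le> ?a * d"
        using powr_one_plus_bounds(1,2)[of d ?a 0] a d d1 by auto
      ultimately have "\<bar>(1 + d) powr (- ?a) - 1\<bar> \<le> 2 * real (Suc k) * d"
        by linarith
      moreover have "s ^ k / (1 + d) - t ^ k = t ^ k * ((1 + d) powr (- ?a) - 1)"
        unfolding w by (simp add: right_diff_distrib)
      ultimately have 2: "\<bar>s ^ k / (1 + d) - t ^ k\<bar> \<le> (3 / 8) ^ k * (2 * real (Suc k) * d)"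
        using t t38 d by (auto simp: abs_mult intro!: mult_mono power_mono)
      have "\<bar>rothe q N (- q) * (s ^ (N - 1) / (1 + d) - t ^ (N - 1))\<bar>
          \<le> (q / real (Suc k) * 3 * crit ^ k) * ((3 / 8) ^ k * (2 * real (Suc k) * d))"
        unfolding abs_mult N diff_Suc_1 using q
        by (intro mult_mono 1 2) (auto simp: crit_def)
      also have "\<dots> = (2 * q) * (3 * d * rate ^ k)"
        unfolding rate_def power_mult_distrib by (simp del: of_nat_Suc)
      also have "\<dots> \<le> 3 * d * rate ^ k"
        using q d rate_bounds by (intro mult_left_le_one_le) auto
      finally show ?thesis by (simp add: N)
    qed
    then have "\<bar>E2\<bar> \<le> (\<Sum>N=2..r. 3 * d * rate ^ (N - 1))"
      unfolding E2_def by (intro order_trans[OF sum_abs] sum_mono)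
    also have "\<dots> = 3 * d * (\<Sum>k\<in>{1..<r}. rate ^ k)"
      unfolding sum_distrib_left
      by (rule sum.reindex_bij_witness[of _ Suc "\<lambda>N. N - 1"]) auto
    also have "\<dots> \<le> 3 * d * (1 / (1 - rate))"
      unfolding sums_unique[OF geom]
      by (intro mult_left_mono sum_le_suminf sums_summable[OF geom]) (use d rate_bounds in auto)
    finally show ?thesis by (simp add: mult.commute)
  qed
  have E3: "\<bar>E3\<bar> \<le> 5 / (1 - rate) * d"
  proof -
    \<comment> \<open>Division by \<open>s\<close> leaves \<open>s ^ (r + k)\<close>, and
      \<open>s ^ r \<le> t ^ r = d\<close> supplies the factor \<open>1 / n\<close>; hence
      truncation at \<open>N = r\<close>.\<close>
    have bound: "norm (f (k + Suc r) / (s * (1 + d))) \<le> 5 * d * rate ^ k" for k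
    proof -
      have "s ^ (r + k) \<le> t ^ (r + k)" using s st by (intro power_mono) auto
      also have "\<dots> \<le> d * (3 / 8) ^ k"
        unfolding power_add tr using t t38 d by (intro mult_left_mono power_mono) auto
      finally have 1: "s ^ (r + k) \<le> d * (3 / 8) ^ k" .
      have 2: "\<bar>rothe q (Suc (r + k)) (- q)\<bar> \<le> 5 * crit ^ k"
        using rothe_tail_bound[OF r, of k] by (simp add: q_def)
      have "norm (f (k + Suc r) / (s * (1 + d))) = \<bar>rothe q (Suc (r + k)) (- q)\<bar> * s ^ (r + k) / (1 + d)"
        using s d by (simp add: f_def abs_mult add.commute)
      also have "\<dots> \<le> \<bar>rothe q (Suc (r + k)) (- q)\<bar> * s ^ (r + k) / 1"
        using s d by (intro divide_left_mono) auto
      also have "\<dots> \<le> (5 * crit ^ k) * (d * (3 / 8) ^ k)"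
        using mult_mono[OF 2 1] s by (simp add: crit_def)
      also have "\<dots> = 5 * d * rate ^ k"
        unfolding rate_def power_mult_distrib by simp
      finally show ?thesis .
    qed
    have "E3 = (\<Sum>k. f (k + Suc r) / (s * (1 + d)))"
      unfolding E3_def using f by (intro suminf_divide[symmetric]) (simp add: summable_iff_shift del: add_Suc_right)
    also have "norm \<dots> \<le> (\<Sum>k. 5 * d * rate ^ k)"
      by (rule norm_suminf_le[OF bound]) (rule sums_summable[OF sums_mult[OF geom]])
    also have "\<dots> = 5 * d * (1 / (1 - rate))"
      by (rule sums_unique[OF sums_mult[OF geom], symmetric])
    finally show ?thesis by (simp add: mult.commute)
  qed
  have "\<bar>E0 + E1 + E2 + E3\<bar> \<le> d + d + 3 / (1 - rate) * d + 5 / (1 - rate) * d"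
    using E0 E1 E2 E3 by linarith
  also have "\<dots> = (2 + 8 / (1 - rate)) * d"
    by (simp add: algebra_simps add_divide_distrib[symmetric])
  finally show ?thesis
    using sol decomp by auto
qed

section \<open>Translation into Gamma values and powers of \<open>n\<close>\<close>

theorem lemma11:
  shows "\<exists>C::real. C > 0 \<and>
    (\<forall>n r :: nat. 2 \<le> r \<and> real r \<le> ln (real n) \<longrightarrow>
      (\<exists>!x. is_pos_sol n r x) \<and>
      (\<forall>x. is_pos_sol n r x \<longrightarrow>
        (\<exists>\<epsilon>::real.
          x = real n powr (1 / real r) - 1 / real r
              - (\<Sum>N=2..r. Gamma (real N + (real N - 1) / real r)
                    / ((real N - 1) * Gamma (real N + 1) * Gamma ((real N - 1) / real r))
                    * real n powr (- ((real N - 1) / real r)))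
              + 1 / real r * real n powr (- 1 + 1 / real r)
              + \<epsilon>
          \<and> \<bar>\<epsilon>\<bar> \<le> C / real n)))"
proof (rule exI[of _ "2 + 8 / (1 - rate)"], intro conjI allI impI)
  let ?C = "2 + 8 / (1 - rate)"
  show "0 < ?C" using rate_bounds by (simp add: add_pos_pos)
  fix n r :: nat
  assume nr: "2 \<le> r \<and> real r \<le> ln (real n)"
  then have n: "real n > 0" by (cases "n = 0") auto
  define q where "q = 1 / real r"
  define t where "t = real n powr (- (1 / real r))"
  have q: "q > 0" using nr by (simp add: q_def)
  obtain y where y: "is_pos_sol n r y"
    and bound: "\<bar>y - (1 / t - q + (\<Sum>N=2..r. rothe q N (- q) * t ^ (N - 1)) + q * (1 / real n) / t)\<bar>
      \<le> ?C * (1 / real n)"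
    using is_pos_sol_expansion[of r n] nr unfolding q_def t_def by blast
  have unique: "x = y" if "is_pos_sol n r x" for x
    using is_pos_sol_unique[OF _ that y] nr by simp
  with y show "\<exists>!x. is_pos_sol n r x" by blast
  fix x assume "is_pos_sol n r x"
  then have "x = y" by (rule unique)
  have "1 / t = real n powr (1 / real r)"
    using n by (simp add: t_def powr_minus field_simps)
  moreover have "q * (1 / real n) / t = 1 / real r * real n powr (- 1 + 1 / real r)"
    using n by (simp add: t_def q_def powr_minus powr_diff field_simps)
  \<comment> \<open>The minus sign comes from \<open>rothe_Gamma\<close>: the coefficients at
    \<open>- q\<close> are negative from \<open>N = 2\<close> on.\<close>
  moreover have "(\<Sum>N=2..r. rothe q N (- q) * t ^ (N - 1)) =
      - (\<Sum>N=2..r. Gamma (real N + (real N - 1) / real r)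
                    / ((real N - 1) * Gamma (real N + 1) * Gamma ((real N - 1) / real r))
                    * real n powr (- ((real N - 1) / real r)))"
    unfolding sum_negf[symmetric]
  proof (rule sum.cong[OF refl])
    fix N assume "N \<in> {2..r}"
    then have N: "N \<ge> 2" by simp
    have "t ^ (N - 1) = t powr (real N - 1)"
      using n N by (simp add: t_def of_nat_diff flip: powr_realpow)
    also have "\<dots> = real n powr (- ((real N - 1) / real r))"
      by (simp add: t_def powr_powr)
    finally show "rothe q N (- q) * t ^ (N - 1) =
        - (Gamma (real N + (real N - 1) / real r)
           / ((real N - 1) * Gamma (real N + 1) * Gamma ((real N - 1) / real r))
           * real n powr (- ((real N - 1) / real r)))"
      using rothe_Gamma[OF N q] by (simp add: q_def)
  qed
  ultimately show "\<exists>\<epsilon>::real.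
          x = real n powr (1 / real r) - 1 / real r
              - (\<Sum>N=2..r. Gamma (real N + (real N - 1) / real r)
                    / ((real N - 1) * Gamma (real N + 1) * Gamma ((real N - 1) / real r))
                    * real n powr (- ((real N - 1) / real r)))
              + 1 / real r * real n powr (- 1 + 1 / real r)
              + \<epsilon>
          \<and> \<bar>\<epsilon>\<bar> \<le> ?C / real n"
    using bound \<open>x = y\<close>
    by (intro exI[of _ "y - (1 / t - q + (\<Sum>N=2..r. rothe q N (- q) * t ^ (N - 1)) + q * (1 / real n) / t)"])
       (simp add: q_def)
qed

end
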